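(* Consider the forward-Euler nodal DG scheme with positivity-preserving limiter for the one-dimensional Euler equations with gravity, $\mathbf U_h^{n+1}=\Pi_h\mathbf U_h^{EF}$, where for $i=1,\dots,N$, $i_1=0,\dots,k$, $$\frac{\Delta x}{2}\,\frac{\mathbf U_{i_1}^{i,EF}-\mathbf U_{i_1}^{i,n}}{\Delta t}+\sum_{l=0}^k2D_{i_1,l}\mathbf F^S(\mathbf U_{i_1}^{i,n},\mathbf U_{l}^{i,n})+\frac{\tau_{i_1}}{\omega_{i_1}}\left(\mathbf F_{i_1}^{*,i}-\mathbf F(\mathbf U_{i_1}^{i,n})\right)=\left(0,\ \rho_{i_1}^{i,n}\Theta_{i_1}^i,\ m_{i_1}^{i,n}\Theta_{i_1}^i\right)^T,$$ $$\Theta_{i_1}^i=\frac{1}{\rho^{e,i}_{i_1}}\sum_{l=0}^k2D_{i_1,l}F_2^S(\mathbf U_{i_1}^{e,i},\mathbf U_l^{e,i}),$$ with fluxes, matrices and limiter $\Pi_h$ as in the context. Assume $\mathbf U_{i_1}^{i,n}\in\mathscr G$ for all $i,i_1$. Then the cell averages of the solution satisfy $\bar{\mathbf U}^{i,n+1}\in\mathscr G$ under the time step restriction $$\lambda=\frac{\Delta t}{\Delta x}<\min\left\{\frac{\omega_0}{4\alpha_0},\ \min_{i,i_1}\left\{\frac{1}{4|\Theta_{i_1}^i|}\sqrt{\frac{1}{(\gamma-1)\beta_{i_1}^i}}\right\}\right\},\qquad \alpha_0=\max_{\Omega}\{|u|+c\},$$ where $\beta_{i_1}^i=\rho_{i_1}^{i,n}/(2p_{i_1}^{i,n})$,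 $\Omega=[a,b]$ is the domain, and $u$, $c$ are the velocity and sound speed of the numerical solution at time level $n$.
   Context: Equations: $\mathbf U_t+\mathbf F(\mathbf U)_x=\mathbf S(\mathbf U,x)$ with $\mathbf U=(\rho,m,\mathcal E)^T$, $m=\rho u$, $\mathbf F(\mathbf U)=(m,\ \rho u^2+p,\ u(\mathcal E+p))^T$, $\mathbf S=(0,-\rho\phi_x,-m\phi_x)^T$, $\phi=\phi(x)$ a given time-independent potential, $\mathcal E=\frac{p}{\gamma-1}+\frac12\rho u^2$, $\gamma=1.4$, sound speed $c=\sqrt{\gamma p/\rho}$. Admissible set: $\mathscr G=\{(\rho,m,\mathcal E):\rho>0,\ p>0\}$ (convex). $\mathbf U^e:[a,b]\to\mathscr G$ is a given hydrostatic steady state: zero velocity and $p^e_x=-\rho^e\phi_x$. Mesh: $[a,b]$ is divided into $N$ uniform cells $K_i=[x_{i-1/2},x_{i+1/2}]$ of size $\Delta x$ and centers $x_i$. Let $-1=X_0<\dots<X_k=1$ be the $k+1$ Gauss–Lobatto points on $[-1,1]$ with weights $\omega_0,\dots,\omega_k$ (so $\sum_l\omega_l=2$), $L_l$ the Lagrange basis with $L_l(X_j)=\delta_{lj}$, $D_{jl}=L_l'(X_j)$, and $\tau_0=-1$, $\tau_k=1$, $\tau_j=0$ for $0<j<k$. $\mathbf U_{i_1}^{i,n}=(\rho^{i,n}_{i_1},m^{i,n}_{i_1},\mathcal E^{i,n}_{i_1})^T$ is the nodal value at time level $n$ at the point $x_i+\frac{\Delta x}2X_{i_1}$ of $K_i$,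 and $p_{i_1}^{i,n}$ its pressure; $\mathbf U_{i_1}^{e,i}$, $\rho^{e,i}_{i_1}$ are the values of $\mathbf U^e$, $\rho^e$ there. The cell average of nodal data is $\bar{\mathbf U}^i=\sum_{i_1=0}^k\frac{\omega_{i_1}}2\mathbf U_{i_1}^i$. Fluxes: $\mathbf F^{*,i}_0=\hat{\mathbf F}(\mathbf U_k^{i-1,n},\mathbf U_0^{i,n})$, $\mathbf F^{*,i}_k=\hat{\mathbf F}(\mathbf U_k^{i,n},\mathbf U_0^{i+1,n})$, $\mathbf F^{*,i}_{i_1}=0$ for $0<i_1<k$; the exterior states at the ends of the domain are given by the boundary conditions and, like all states, lie in $\mathscr G$. $\hat{\mathbf F}$ is the Lax–Friedrichs flux $$\hat{\mathbf F}(\mathbf U_L,\mathbf U_R)=\tfrac12(\mathbf F(\mathbf U_L)+\mathbf F(\mathbf U_R))-\tfrac\alpha2(\mathbf U_R-\mathbf U_L),\qquad \alpha=\max\{|u_L|+c_L,|u_R|+c_R,\alpha^{RRF}(\mathbf U_L,\mathbf U_R)\},$$ with $\alpha^{RRF}$ the two-rarefaction estimate of the maximal wave speed of the Riemann problem. $\mathbf F^S=(F_1^S,F_2^S,F_3^S)^T$ is an entropy conservative flux: consistent ($\mathbf F^S(\mathbf U,\mathbf U)=\mathbf F(\mathbf U)$), symmetric in its arguments, and $(\mathbf V_R-\mathbf V_L)^T\mathbf F^S(\mathbf U_L,\mathbf U_R)=\psi_R-\psi_L$, where $\mathbf V=\left(\frac{\gamma-s}{\gamma-1}-\frac{\rho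 u^2}{2p},\frac{\rho u}p,-\frac\rho p\right)^T$, $s=\ln(p\rho^{-\gamma})$, $\psi=\rho u$. Limiter $\Pi_h$: in each cell, $$\tilde\rho_{i_1}^{i,EF}=(1-\theta_i^{(1)})\bar\rho^{i,EF}+\theta_i^{(1)}\rho_{i_1}^{i,EF},\qquad \mathbf U_{i_1}^{i,n+1}=(1-\theta_i^{(2)})\bar{\mathbf U}^{i,EF}+\theta_i^{(2)}\widetilde{\mathbf U}_{i_1}^{i,EF},\qquad \widetilde{\mathbf U}_{i_1}^{i,EF}=(\tilde\rho_{i_1}^{i,EF},m_{i_1}^{i,EF},\mathcal E_{i_1}^{i,EF})^T,$$ with $\theta_i^{(1)},\theta_i^{(2)}\in[0,1]$, $\theta_i^{(1)}=\min\left\{\frac{\bar\rho^{i,EF}-\varepsilon}{\bar\rho^{i,EF}-\min_{i_1}\rho_{i_1}^{i,EF}},1\right\}$, $\theta_i^{(2)}=\min_{i_1}t_{i_1}$, where $t_{i_1}=1$ if $p(\widetilde{\mathbf U}_{i_1}^{i,EF})\ge\varepsilon$ and otherwise $t_{i_1}$ solves $p\left((1-t)\bar{\mathbf U}^{i,EF}+t\,\widetilde{\mathbf U}_{i_1}^{i,EF}\right)=\varepsilon$; $\varepsilon=10^{-13}$.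
   Formalization: Added: λ < ω_0/(4α) for the Lax–Friedrichs coefficient α at every cell interface, domain ends included; without it the claim fails, as α^RRF (and exterior states) can make α far exceed α_0. Nodes with Θ = 0 impose no time-step restriction. *)

theory Defs
  imports "HOL-Analysis.Analysis" "HOL-Computational_Algebra.Polynomial"
begin

section \<open>The Euler equations with gravity\<close>

text \<open>A state is the triple of conservative variables \<open>(\<rho>, m, \<E>)\<close>; vectors in three-dimensional
  space are such triples, with the componentwise vector space structure and the standard inner
  product of the product type.\<close>

type_synonym state = "real \<times> real \<times> real"

definition gam :: real where "gam = 7 / 5"

definition dens :: "state \<Rightarrow> real" where "dens U = fst U"
definition mom :: "state \<Rightarrow> real" where "mom U = fst (snd U)"
definition ener :: "state \<Rightarrow> real" where "ener U = snd (snd U)"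

definition vel :: "state \<Rightarrow> real" where "vel U = mom U / dens U"

text \<open>The equation of state \<open>\<E> = p / (\<gamma> - 1) + \<rho> u\<^sup>2 / 2\<close>, solved for \<open>p\<close>.\<close>

definition pres :: "state \<Rightarrow> real" where
  "pres U = (gam - 1) * (ener U - dens U * (vel U)\<^sup>2 / 2)"

definition csnd :: "state \<Rightarrow> real" where
  "csnd U = sqrt (gam * pres U / dens U)"

definition admissible :: "state set" where
  "admissible = {U. dens U > 0 \<and> pres U > 0}"

definition flux :: "state \<Rightarrow> state" where
  "flux U = (mom U, dens U * (vel U)\<^sup>2 + pres U, vel U * (ener U + pres U))"

definition hydrostatic :: "real \<Rightarrow> real \<Rightarrow> (real \<Rightarrow> real) \<Rightarrow> (real \<Rightarrow> state) \<Rightarrow> bool" where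
  "hydrostatic a b \<phi> Ue \<longleftrightarrow>
     (\<forall>x\<in>{a..b}. Ue x \<in> admissible \<and> vel (Ue x) = 0 \<and>
        (\<exists>\<phi>x. (\<phi> has_real_derivative \<phi>x) (at x within {a..b}) \<and>
              ((\<lambda>y. pres (Ue y)) has_real_derivative - dens (Ue x) * \<phi>x) (at x within {a..b})))"

section \<open>Entropy conservative and Lax--Friedrichs fluxes\<close>

definition entropy_var :: "state \<Rightarrow> state" where
  "entropy_var U =
     ((gam - ln (pres U * dens U powr (- gam))) / (gam - 1) - dens U * (vel U)\<^sup>2 / (2 * pres U),
      dens U * vel U / pres U,
      - dens U / pres U)"

definition entropy_pot :: "state \<Rightarrow> real" where
  "entropy_pot U = dens U * vel U"

definition entropy_conservative :: "(state \<Rightarrow> state \<Rightarrow> state) \<Rightarrow> bool" where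
  "entropy_conservative FS \<longleftrightarrow>
     (\<forall>U\<in>admissible. FS U U = flux U) \<and>
     (\<forall>UL\<in>admissible. \<forall>UR\<in>admissible. FS UL UR = FS UR UL) \<and>
     (\<forall>UL\<in>admissible. \<forall>UR\<in>admissible.
        (entropy_var UR - entropy_var UL) \<bullet> FS UL UR = entropy_pot UR - entropy_pot UL)"

text \<open>The two-rarefaction estimate: the exact pressure of the star region under the assumption that
  both nonlinear waves are rarefactions (\<open>0\<close> if they produce a vacuum) is inserted into the speeds
  of the left-most and of the right-most wave, a wave being a shock precisely if the
  pressure rises across it.\<close>

definition rrf_pres :: "state \<Rightarrow> state \<Rightarrow> real" where
  "rrf_pres UL UR =
     (max 0 (csnd UL + csnd UR - (gam - 1) / 2 * (vel UR - vel UL)) /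
      (csnd UL / pres UL powr ((gam - 1) / (2 * gam)) +
       csnd UR / pres UR powr ((gam - 1) / (2 * gam)))) powr (2 * gam / (gam - 1))"

definition wave_factor :: "real \<Rightarrow> real \<Rightarrow> real" where
  "wave_factor ps p = sqrt (1 + (gam + 1) / (2 * gam) * max 0 (ps / p - 1))"

definition rrf_speed :: "state \<Rightarrow> state \<Rightarrow> real" where
  "rrf_speed UL UR =
     max \<bar>vel UL - csnd UL * wave_factor (rrf_pres UL UR) (pres UL)\<bar>
         \<bar>vel UR + csnd UR * wave_factor (rrf_pres UL UR) (pres UR)\<bar>"

definition lf_speed :: "state \<Rightarrow> state \<Rightarrow> real" where
  "lf_speed UL UR =
     max (\<bar>vel UL\<bar> + csnd UL) (max (\<bar>vel UR\<bar> + csnd UR) (rrf_speed UL UR))"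

definition lf_flux :: "state \<Rightarrow> state \<Rightarrow> state" where
  "lf_flux UL UR =
     (1 / 2) *\<^sub>R (flux UL + flux UR) - (lf_speed UL UR / 2) *\<^sub>R (UR - UL)"

section \<open>Gauss--Lobatto nodes\<close>

text \<open>Rodrigues' formula.\<close>

definition legendre :: "nat \<Rightarrow> real poly" where
  "legendre k = smult (1 / (2 ^ k * fact k)) ((pderiv ^^ k) ([:-1, 0, 1:] ^ k))"

definition lagrange :: "nat \<Rightarrow> (nat \<Rightarrow> real) \<Rightarrow> nat \<Rightarrow> real poly" where
  "lagrange k X l = (\<Prod>j\<in>{..k} - {l}. smult (1 / (X l - X j)) [:- X j, 1:])"

text \<open>The end points of the interval together with the \<open>k - 1\<close> zeros of the derivative of the
  Legendre polynomial of degree \<open>k\<close>; the weights are those of the interpolatory quadrature.\<close>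

definition gauss_lobatto :: "nat \<Rightarrow> (nat \<Rightarrow> real) \<Rightarrow> (nat \<Rightarrow> real) \<Rightarrow> bool" where
  "gauss_lobatto k X \<omega> \<longleftrightarrow>
     strict_mono_on {..k} X \<and> X 0 = -1 \<and> X k = 1 \<and>
     (\<forall>j. 0 < j \<and> j < k \<longrightarrow> poly (pderiv (legendre k)) (X j) = 0) \<and>
     (\<forall>l\<le>k. \<omega> l = integral {-1..1} (poly (lagrange k X l)))"

definition diffmat :: "nat \<Rightarrow> (nat \<Rightarrow> real) \<Rightarrow> nat \<Rightarrow> nat \<Rightarrow> real" where
  "diffmat k X j l = poly (pderiv (lagrange k X l)) (X j)"

definition tau :: "nat \<Rightarrow> nat \<Rightarrow> real" where
  "tau k j = (if j = 0 then -1 else if j = k then 1 else 0)"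

definition cell_avg :: "nat \<Rightarrow> (nat \<Rightarrow> real) \<Rightarrow> (nat \<Rightarrow> state) \<Rightarrow> state" where
  "cell_avg k \<omega> V = (\<Sum>j\<le>k. (\<omega> j / 2) *\<^sub>R V j)"

section \<open>The scheme\<close>

definition mesh_size :: "real \<Rightarrow> real \<Rightarrow> nat \<Rightarrow> real" where
  "mesh_size a b N = (b - a) / real N"

text \<open>The cells are numbered from \<open>1\<close> to \<open>N\<close>; the centre of cell \<open>i\<close> is \<open>a + (i - 1/2) \<Delta>x\<close>.\<close>

definition mesh_node :: "real \<Rightarrow> real \<Rightarrow> nat \<Rightarrow> (nat \<Rightarrow> real) \<Rightarrow> nat \<Rightarrow> nat \<Rightarrow> real" where
  "mesh_node a b N X i j =
     a + (real i - 1 / 2) * mesh_size a b N + mesh_size a b N / 2 * X j"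

text \<open>Nodal data \<open>U i j\<close> belong to node \<open>j\<close> of cell \<open>i\<close>. The exterior states at the two ends of the
  domain are stored as \<open>U 0 k\<close> and \<open>U (N + 1) 0\<close>.\<close>

definition interface_flux :: "nat \<Rightarrow> (nat \<Rightarrow> nat \<Rightarrow> state) \<Rightarrow> nat \<Rightarrow> nat \<Rightarrow> state" where
  "interface_flux k U i j =
     (if j = 0 then lf_flux (U (i - 1) k) (U i 0)
      else if j = k then lf_flux (U i k) (U (i + 1) 0)
      else 0)"

text \<open>\<open>Ve l\<close> is the steady state at node \<open>l\<close> of the cell; \<open>mom\<close> extracts the second component
  of the flux.\<close>

definition source_coeff ::
  "nat \<Rightarrow> (nat \<Rightarrow> real) \<Rightarrow> (state \<Rightarrow> state \<Rightarrow> state) \<Rightarrow> (nat \<Rightarrow> state) \<Rightarrow> nat \<Rightarrow> real" where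
  "source_coeff k X FS Ve j =
     1 / dens (Ve j) * (\<Sum>l\<le>k. 2 * diffmat k X j l * mom (FS (Ve j) (Ve l)))"

definition max_speed :: "nat \<Rightarrow> nat \<Rightarrow> (nat \<Rightarrow> nat \<Rightarrow> state) \<Rightarrow> real" where
  "max_speed N k U = Max {\<bar>vel (U i j)\<bar> + csnd (U i j) | i j. i \<in> {1..N} \<and> j \<le> k}"

section \<open>The positivity-preserving limiter\<close>

definition lim_eps :: real where "lim_eps = 1 / 10 ^ 13"

text \<open>If all nodal densities of a cell agree, the quotient below is \<open>x / 0 = 0\<close>. This is harmless:
  the limited densities then coincide with the mean for every value of the parameter.\<close>

definition theta1 :: "nat \<Rightarrow> (nat \<Rightarrow> real) \<Rightarrow> (nat \<Rightarrow> state) \<Rightarrow> real" where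
  "theta1 k \<omega> V =
     min ((dens (cell_avg k \<omega> V) - lim_eps) /
          (dens (cell_avg k \<omega> V) - Min ((\<lambda>j. dens (V j)) ` {..k}))) 1"

definition lim_dens :: "nat \<Rightarrow> (nat \<Rightarrow> real) \<Rightarrow> (nat \<Rightarrow> state) \<Rightarrow> nat \<Rightarrow> state" where
  "lim_dens k \<omega> V j =
     ((1 - theta1 k \<omega> V) * dens (cell_avg k \<omega> V) + theta1 k \<omega> V * dens (V j),
      mom (V j), ener (V j))"

text \<open>Taking the root by Hilbert choice makes the limiter a total function, so that its use does
  not presuppose the positivity of the cell average on which the existence of the root rests.
  If the cell average has density and pressure at least \<open>lim_eps\<close>, then such a root exists
  whenever the pressure of the state is below \<open>lim_eps\<close>, and both limiting parameters lie
  in \<open>[0, 1]\<close>.\<close>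

definition lim_root :: "state \<Rightarrow> state \<Rightarrow> real" where
  "lim_root Ubar W =
     (if pres W \<ge> lim_eps then 1
      else (SOME t. 0 \<le> t \<and> t \<le> 1 \<and> pres ((1 - t) *\<^sub>R Ubar + t *\<^sub>R W) = lim_eps))"

definition theta2 :: "nat \<Rightarrow> (nat \<Rightarrow> real) \<Rightarrow> (nat \<Rightarrow> state) \<Rightarrow> real" where
  "theta2 k \<omega> V = Min ((\<lambda>j. lim_root (cell_avg k \<omega> V) (lim_dens k \<omega> V j)) ` {..k})"

definition limiter :: "nat \<Rightarrow> (nat \<Rightarrow> real) \<Rightarrow> (nat \<Rightarrow> state) \<Rightarrow> nat \<Rightarrow> state" where
  "limiter k \<omega> V j =
     (1 - theta2 k \<omega> V) *\<^sub>R cell_avg k \<omega> V + theta2 k \<omega> V *\<^sub>R lim_dens k \<omega> V j"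

end

theory Submission
  imports Defs
begin

text \<open>The limiter preserves cell averages. By the summation-by-parts property of the Gauss--Lobatto
  differentiation matrix and the symmetry of the entropy conservative flux, the volume terms of the
  scheme cancel against the physical fluxes at the end points of the cell, so the new average is
  \<open>\<Sum>\<^sub>j \<omega>\<^sub>j / 4 ((U\<^sub>j - 4 \<lambda> \<tau>\<^sub>j / \<omega>\<^sub>j F\<^sup>*\<^sub>j) + (U\<^sub>j + 4 \<lambda> S\<^sub>j))\<close>, where \<open>F\<^sup>*\<close> is the
  interface flux and \<open>S\<close> the source term. The first bracket is admissible because a
  Lax--Friedrichs flux splits it into the states \<open>\<alpha> U \<plusminus> F(U)\<close>. In the second the source
  only shifts the velocity by \<open>4 \<lambda> \<Theta>\<close>, at the expense of the internal energy
  \<open>\<rho> (4 \<lambda> \<Theta>)\<^sup>2 / 2\<close>.\<close>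

section \<open>Gauss--Lobatto quadrature\<close>

lemma poly_integrable [simp]: "poly p integrable_on {a..b::real}"
  by (intro integrable_continuous_real continuous_intros)

lemma integral_poly_pderiv:
  fixes p :: "real poly"
  assumes "a \<le> b"
  shows "integral {a..b} (poly (pderiv p)) = poly p b - poly p a"
  using assms
  by (intro integral_unique fundamental_theorem_of_calculus)
     (auto simp: has_real_derivative_iff_has_vector_derivative [symmetric]
           intro: DERIV_subset [OF poly_DERIV])

lemma integral_poly_add:
  fixes p q :: "real poly"
  shows "integral {a..b} (poly (p + q)) = integral {a..b} (poly p) + integral {a..b} (poly q)"
  using integral_add [OF poly_integrable [of p a b] poly_integrable [of q a b]]
  by (simp add: poly_add [abs_def])

lemma integral_poly_sum_smult:
  fixes p :: "'a \<Rightarrow> real poly"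
  assumes "finite A"
  shows "integral {a..b} (poly (\<Sum>i\<in>A. smult (c i) (p i)))
       = (\<Sum>i\<in>A. c i * integral {a..b} (poly (p i)))"
proof -
  have "integral {a..b} (poly (\<Sum>i\<in>A. smult (c i) (p i)))
      = integral {a..b} (\<lambda>x. \<Sum>i\<in>A. c i * poly (p i) x)"
    by (intro arg_cong [of _ _ "integral {a..b}"]) (simp add: fun_eq_iff poly_sum)
  also have "\<dots> = (\<Sum>i\<in>A. integral {a..b} (\<lambda>x. c i * poly (p i) x))"
    using assms by (intro integral_sum integrable_on_mult_right) auto
  finally show ?thesis by simp
qed

lemma integral_poly_smult:
  fixes p :: "real poly"
  shows "integral {a..b} (poly (smult c p)) = c * integral {a..b} (poly p)"
  by (simp add: poly_smult [abs_def])

lemma integral_poly_0 [simp]: "integral {a..b::real} (poly 0) = 0"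
  by (simp add: poly_0 [abs_def])

section \<open>Legendre polynomials: orthogonality and parity\<close>

lemma power_dvd_pderiv:
  fixes w p :: "real poly"
  assumes "w ^ Suc m dvd p"
  shows "w ^ m dvd pderiv p"
proof -
  from assms obtain r where p: "p = w ^ Suc m * r" by (elim dvdE)
  have "pderiv p = w ^ m * (w * pderiv r + smult (of_nat (Suc m)) (pderiv w) * r)"
    unfolding p pderiv_mult pderiv_power_Suc
    by (simp add: algebra_simps del: of_nat_Suc)
  thus ?thesis by simp
qed

text \<open>Each differentiation costs at most one factor \<open>w\<close>. For \<open>n < k\<close>
  a factor is left, so the derivative still vanishes at the zeros of \<open>w\<close>; this removes
  the boundary terms in the integration by parts below.\<close>

lemma power_dvd_higher_pderiv:
  fixes w :: "real poly"
  assumes "n \<le> k"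
  shows "w ^ (k - n) dvd (pderiv ^^ n) (w ^ k)"
  using assms
proof (induction n)
  case (Suc n)
  hence "w ^ Suc (k - Suc n) dvd (pderiv ^^ n) (w ^ k)"
    by (simp add: Suc_diff_Suc del: power_Suc)
  thus ?case by (simp only: funpow.simps o_apply power_dvd_pderiv)
qed simp

text \<open>Repeated integration by parts: all boundary terms vanish.\<close>

lemma integral_mult_higher_pderiv:
  fixes q w :: "real poly"
  assumes "a \<le> b" "poly w a = 0" "poly w b = 0"
    and "n \<le> k" "(pderiv ^^ n) q = 0"
  shows "integral {a..b} (poly (q * (pderiv ^^ n) (w ^ k))) = 0"
  using assms(4,5)
proof (induction n arbitrary: q)
  case (Suc n)
  let ?D = "(pderiv ^^ n) (w ^ k)"
  have "w dvd w ^ (k - n)" using Suc.prems by (intro dvd_power) auto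
  also have "\<dots> dvd ?D" using Suc.prems by (intro power_dvd_higher_pderiv) auto
  finally obtain s where s: "?D = w * s" by (elim dvdE)
  have "poly q b * poly ?D b - poly q a * poly ?D a
      = integral {a..b} (poly (q * (pderiv ^^ Suc n) (w ^ k) + ?D * pderiv q))"
    using integral_poly_pderiv [OF assms(1), of "q * ?D"] by (simp add: pderiv_mult)
  also have "\<dots> = integral {a..b} (poly (q * (pderiv ^^ Suc n) (w ^ k)))
               + integral {a..b} (poly (pderiv q * ?D))"
    by (simp only: integral_poly_add mult.commute [of ?D])
  also have "integral {a..b} (poly (pderiv q * ?D)) = 0"
    using Suc.prems by (intro Suc.IH) (auto simp del: funpow.simps simp add: funpow_Suc_right)
  finally show ?case using assms by (simp add: s)
qed simp

text \<open>Rodrigues' formula gives a \<open>k\<close>-th derivative; \<open>k\<close> integrations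
  by parts move it onto \<open>q\<close>, whose \<open>k\<close>-th derivative is zero.\<close>

lemma legendre_orthogonal:
  assumes "degree q < k"
  shows "integral {-1..1} (poly (q * legendre k)) = 0"
proof -
  have "(pderiv ^^ k) q = 0"
    using assms by (intro poly_eqI) (simp add: coeff_higher_pderiv coeff_eq_0)
  hence "integral {-1..1} (poly (q * (pderiv ^^ k) ([:-1, 0, 1:] ^ k))) = 0"
    by (intro integral_mult_higher_pderiv) auto
  thus ?thesis by (simp add: legendre_def integral_poly_smult)
qed

lemma degree_pderiv_legendre: "degree (pderiv (legendre k)) = k - 1"
  by (simp add: legendre_def degree_pderiv degree_higher_pderiv degree_power_eq)

lemma pderiv_legendre_nonzero:
  assumes "k \<ge> 1"
  shows "pderiv (legendre k) \<noteq> 0"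
  using assms
  by (simp add: pderiv_eq_0_iff legendre_def degree_higher_pderiv degree_power_eq)

lemma higher_pderiv_reflect:
  fixes p :: "real poly"
  shows "poly ((pderiv ^^ n) (pcompose p [:0, -1:])) x = (-1) ^ n * poly ((pderiv ^^ n) p) (- x)"
proof -
  have "(pderiv ^^ n) (pcompose p [:0, -1:]) = smult ((-1) ^ n) (pcompose ((pderiv ^^ n) p) [:0, -1:])"
    by (induction n) (simp_all add: pderiv_smult pderiv_pcompose pderiv_pCons)
  thus ?thesis by (simp add: poly_pcompose)
qed

text \<open>Powers of x^2 - 1 are even, so their derivatives are even or odd; squaring absorbs the
  sign and treats both parities of \<open>k\<close> at once.\<close>

lemma pderiv_legendre_reflect:
  "(poly (pderiv (legendre k)) (- x))\<^sup>2 = (poly (pderiv (legendre k)) x)\<^sup>2"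
proof -
  have "pcompose ([:-1, 0, 1:] ^ k) [:0, -1:] = ([:-1, 0, 1:] ^ k :: real poly)"
    by (induction k) (simp_all add: pcompose_mult pcompose_pCons pcompose_1 del: mult_pCons_left)
  hence "poly ((pderiv ^^ Suc k) ([:-1, 0, 1:] ^ k)) x
      = (-1) ^ Suc k * poly ((pderiv ^^ Suc k) ([:-1, 0, 1:] ^ k)) (- x)"
    using higher_pderiv_reflect [of "Suc k" "[:-1, 0, 1:] ^ k" x] by (simp del: funpow.simps)
  thus ?thesis
    by (simp add: legendre_def pderiv_smult power_mult_distrib power_divide flip: power_mult)
qed

section \<open>Lagrange interpolation\<close>

lemma degree_lagrange_le:
  assumes "l \<le> k"
  shows "degree (lagrange k X l) \<le> k"
proof -
  have deg: "degree (smult c [:- x, 1:]) \<le> 1" for c x :: real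
    by (rule order.trans [OF degree_smult_le]) simp
  have "degree (lagrange k X l)
      \<le> (\<Sum>j\<in>{..k} - {l}. degree (smult (1 / (X l - X j)) [:- X j, 1:]))"
    unfolding lagrange_def by (rule order.trans [OF degree_prod_sum_le]) (simp_all only: o_def finite_Diff finite_atMost order.refl)
  also have "\<dots> \<le> (\<Sum>j\<in>{..k} - {l}. 1)" by (intro sum_mono deg)
  finally have "degree (lagrange k X l) \<le> (\<Sum>j\<in>{..k} - {l}. 1)" .
  thus ?thesis using assms by simp
qed

lemma poly_lagrange:
  assumes "inj_on X {..k}" "j \<le> k" "l \<le> k"
  shows "poly (lagrange k X l) (X j) = of_bool (j = l)"
proof (cases "j = l")
  case True
  have "poly (smult (1 / (X l - X i)) [:- X i, 1:]) (X l) = 1" if "i \<in> {..k} - {l}" for i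
    using that assms by (auto simp: inj_on_def simp flip: diff_divide_distrib)
  thus ?thesis using True by (simp add: lagrange_def poly_prod del: smult_pCons)
next
  case False
  thus ?thesis using assms by (auto simp: lagrange_def poly_prod)
qed

lemma lagrange_interpolation:
  assumes "inj_on X {..k}" "degree r \<le> k"
  shows "r = (\<Sum>l\<le>k. smult (poly r (X l)) (lagrange k X l))" (is "_ = ?s")
proof (rule poly_eqI_degree)
  fix x assume "x \<in> X ` {..k}"
  then obtain j where j: "j \<le> k" "x = X j" by auto
  have "poly ?s x = (\<Sum>l\<le>k. poly r (X l) * of_bool (j = l))"
    using assms j by (simp add: poly_sum poly_lagrange)
  thus "poly r x = poly ?s x" using j by (simp add: of_bool_def if_distrib cong: if_cong)
next
  show "card (X ` {..k}) > degree r" using assms by (simp add: card_image)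
  have "degree ?s \<le> k"
    by (intro degree_sum_le) (auto intro: order.trans [OF degree_smult_le] degree_lagrange_le)
  thus "card (X ` {..k}) > degree ?s" using assms by (simp add: card_image)
qed

section \<open>The Gauss-Lobatto rule: degree of exactness and weights\<close>

locale gauss_lobatto_rule =
  fixes k :: nat and X \<omega> :: "nat \<Rightarrow> real"
  assumes k: "k \<ge> 1" and gl: "gauss_lobatto k X \<omega>"
begin

lemma nodes:
  "strict_mono_on {..k} X" "X 0 = -1" "X k = 1"
  "\<And>j. 0 < j \<Longrightarrow> j < k \<Longrightarrow> poly (pderiv (legendre k)) (X j) = 0"
  "\<And>l. l \<le> k \<Longrightarrow> \<omega> l = integral {-1..1} (poly (lagrange k X l))"
  using gl by (auto simp: gauss_lobatto_def)

lemma nodes_inj: "inj_on X {..k}"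
  using nodes(1) by (rule strict_mono_on_imp_inj_on)

lemma node_bounds:
  assumes "l \<le> k"
  shows "l \<noteq> 0 \<Longrightarrow> -1 < X l" "l \<noteq> k \<Longrightarrow> X l < 1"
  using assms strict_mono_onD [OF nodes(1), of 0 l] strict_mono_onD [OF nodes(1), of l k] nodes(2,3)
  by auto

lemma quadrature_exact_low:
  assumes "degree r \<le> k"
  shows "integral {-1..1} (poly r) = (\<Sum>l\<le>k. \<omega> l * poly r (X l))"
proof -
  have "integral {-1..1} (poly r)
      = integral {-1..1} (poly (\<Sum>l\<le>k. smult (poly r (X l)) (lagrange k X l)))"
    using lagrange_interpolation [OF nodes_inj assms] by simp
  also have "\<dots> = (\<Sum>l\<le>k. \<omega> l * poly r (X l))"
    by (simp add: integral_poly_sum_smult nodes(5) mult.commute)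
  finally show ?thesis .
qed

text \<open>Division by \<open>(x\<^sup>2 - 1) P\<^sub>k'\<close>, which vanishes at all nodes, reduces to low degree; the
  quotient has degree at most \<open>k - 2\<close>, so its contribution integrates to zero by parts.\<close>

lemma quadrature_exact:
  assumes "degree f \<le> 2 * k - 1"
  shows "integral {-1..1} (poly f) = (\<Sum>l\<le>k. \<omega> l * poly f (X l))"
proof -
  define P where "P = legendre k"
  define v :: "real poly" where "v = [:-1, 0, 1:]"
  define W where "W = v * pderiv P"
  define q where "q = f div W"
  define r where "r = f mod W"
  have P': "pderiv P \<noteq> 0" using pderiv_legendre_nonzero [OF k] by (simp add: P_def)
  have v: "v \<noteq> 0" "degree v = 2" by (simp_all add: v_def)
  have W: "W \<noteq> 0" "degree W = k + 1"
    using P' v k degree_pderiv_legendre [of k] by (simp_all add: W_def degree_mult_eq P_def)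
  have f: "f = q * W + r" by (simp add: q_def r_def)
  have r: "degree r \<le> k"
    using degree_mod_less [OF W(1), of f] W(2) by (auto simp: r_def)
  have W0: "poly W (X l) = 0" if l: "l \<le> k" for l
  proof -
    consider "l = 0" | "l = k" | "0 < l" "l < k" using l by linarith
    thus ?thesis using nodes by cases (auto simp: W_def v_def P_def)
  qed
  have "integral {-1..1} (poly (q * W)) = 0"
  proof (cases "q = 0")
    case False
    \<comment> \<open>Since \<open>r\<close> has degree at most \<open>k\<close>, hence at most
      \<open>2 * k - 1\<close>, the bound on \<open>f\<close> carries over to \<open>q * W\<close>;
      removing \<open>W\<close> leaves degree at most \<open>k - 2\<close> for
      \<open>q\<close>.\<close>
    have "degree (q * W) \<le> 2 * k - 1"
    proof -
      have "degree (q * W) = degree (f - r)" by (simp add: f)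
      also have "\<dots> \<le> 2 * k - 1" using assms r k by (intro degree_diff_le) auto
      finally show ?thesis .
    qed
    hence dq: "degree q + (k + 1) \<le> 2 * k - 1"
      using False W by (simp add: degree_mult_eq)
    \<comment> \<open>\<open>q * v\<close> has degree at most \<open>k\<close>, so its derivative is
      orthogonal to \<open>P\<close>, while \<open>q * v * P\<close> vanishes at both end points
      because \<open>v\<close> does.\<close>
    have "degree (pderiv (q * v)) < k"
      using dq False v by (simp add: degree_pderiv degree_mult_eq)
    hence "integral {-1..1} (poly (pderiv (q * v) * P)) = 0"
      unfolding P_def by (rule legendre_orthogonal)
    moreover have "integral {-1..1} (poly (pderiv (q * v * P))) = 0"
      by (simp add: integral_poly_pderiv v_def)
    moreover have "pderiv (q * v * P) = q * W + pderiv (q * v) * P"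
      by (simp add: pderiv_mult W_def algebra_simps)
    ultimately show ?thesis by (simp add: integral_poly_add)
  qed simp
  hence "integral {-1..1} (poly f) = integral {-1..1} (poly r)"
    by (subst f) (simp add: integral_poly_add)
  also have "\<dots> = (\<Sum>l\<le>k. \<omega> l * poly r (X l))" using r by (rule quadrature_exact_low)
  also have "\<dots> = (\<Sum>l\<le>k. \<omega> l * poly f (X l))"
    by (intro sum.cong) (auto simp: f W0)
  finally show ?thesis .
qed

lemma sum_weights: "(\<Sum>l\<le>k. \<omega> l) = 2"
  using quadrature_exact [of 1] by (simp add: poly_1 [abs_def])

text \<open>The test polynomial \<open>G\<close> is nonnegative on [-1, 1] and vanishes at every
  node except \<open>X l\<close>, so its integral is \<open>\<omega> l * poly G (X l)\<close>.
  Interior nodes enter squared; the end points enter through the simple factors 1 + x and 1 - x,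
  which keep their sign on the interval and save the degrees that exactness demands.\<close>

lemma weight_pos:
  assumes l: "l \<le> k"
  shows "\<omega> l > 0"
proof -
  define A where "A = {..k} - {l, 0, k}"
  define Q where "Q = (\<Prod>j\<in>A. [:- X j, 1:])"
  define B where "B = (if l = 0 then 1 else [:1, 1:]) * (if l = k then 1 else [:1, -1:] :: real poly)"
  define G where "G = Q\<^sup>2 * B"
  have "finite A" by (simp add: A_def)
  have dQ: "degree Q \<le> card A"
    unfolding Q_def by (rule order.trans [OF degree_prod_sum_le]) (auto simp: \<open>finite A\<close>)
  have cA: "card A = k + 1 - card {l, 0, k}"
    using l by (simp add: A_def card_Diff_subset)
  have "degree G \<le> 2 * card A + degree B"
    unfolding G_def power2_eq_square using dQ
    by (intro order.trans [OF degree_mult_le] add_mono order.trans [OF degree_mult_le]) auto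
  \<comment> \<open>The count gives at most 2 (k - 2) + 2 for an interior \<open>l\<close> and 2 (k
    - 1) + 1 for an end point.\<close>
  also have "\<dots> \<le> 2 * k - 1"
  proof -
    have "degree B \<le> (if l = 0 then 0 else 1) + (if l = k then 0 else 1)"
      unfolding B_def by (intro order.trans [OF degree_mult_le] add_mono) auto
    thus ?thesis using k l by (auto simp: cA card_insert_if split: if_splits)
  qed
  finally have "integral {-1..1} (poly G) = (\<Sum>j\<le>k. \<omega> j * poly G (X j))"
    by (rule quadrature_exact)
  also have "\<dots> = (\<Sum>j\<le>k. if j = l then \<omega> l * poly G (X l) else 0)"
  proof (intro sum.cong refl)
    fix j assume j: "j \<in> {..k}"
    have "poly G (X j) = 0" if jl: "j \<noteq> l"
    proof -
      consider "j \<in> A" | "j = 0" | "j = k" using jl j by (auto simp: A_def)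
      thus ?thesis
      proof cases
        case 1
        thus ?thesis using \<open>finite A\<close> by (auto simp: G_def Q_def poly_prod)
      qed (use jl nodes in \<open>auto simp: G_def B_def\<close>)
    qed
    thus "\<omega> j * poly G (X j) = (if j = l then \<omega> l * poly G (X l) else 0)" by auto
  qed
  finally have int: "integral {-1..1} (poly G) = \<omega> l * poly G (X l)" using l by simp
  have Gpos: "poly G (X l) > 0"
  proof -
    have "poly Q (X l) \<noteq> 0"
      using l nodes_inj \<open>finite A\<close> by (auto simp: Q_def poly_prod A_def inj_on_def)
    moreover have "poly B (X l) > 0" using node_bounds [OF l] nodes(2,3) k by (auto simp: B_def)
    ultimately show ?thesis by (simp add: G_def)
  qed
  have Xl: "X l \<in> {-1..1}" using node_bounds [OF l] nodes(2,3) by force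
  have nonneg: "poly G x \<ge> 0" if "x \<in> {-1..1}" for x
    using that by (simp add: G_def B_def)
  have "integral {-1..1} (poly G) \<noteq> 0"
    using integral_eq_0_iff [of "-1" 1 "poly G"] nonneg Xl Gpos by (force intro: continuous_intros)
  moreover have "integral {-1..1} (poly G) \<ge> 0"
    using nonneg by (intro integral_nonneg) auto
  ultimately show ?thesis using int Gpos by (metis less_eq_real_def zero_less_mult_pos2)
qed

text \<open>The weights are compared by integrating the odd function \<open>x P\<^sub>k'(x)\<^sup>2\<close>.\<close>

lemma weight_last: "\<omega> k = \<omega> 0"
proof -
  define P' where "P' = pderiv (legendre k)"
  define G where "G = [:0, 1:] * P'\<^sup>2"
  have P': "P' \<noteq> 0" "degree P' = k - 1"
    using pderiv_legendre_nonzero [OF k] degree_pderiv_legendre [of k] by (auto simp: P'_def)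
  have inner: "poly P' (X j) = 0" if "0 < j" "j < k" for j
    using nodes(4) that by (simp add: P'_def)
  have refl: "(poly P' (- x))\<^sup>2 = (poly P' x)\<^sup>2" for x
    unfolding P'_def by (rule pderiv_legendre_reflect)
  have "poly G (- x) = - poly G x" for x by (simp add: G_def refl)
  hence "integral {-1..1} (poly G) = - integral {-1..1} (poly G)"
    using Henstock_Kurzweil_Integration.integral_reflect_real [of 1 "-1" "poly G"] by simp
  hence "integral {-1..1} (poly G) = 0" by simp
  hence "0 = integral {-1..1} (poly G)" by simp
  also have "\<dots> = (\<Sum>l\<le>k. \<omega> l * poly G (X l))"
    using k P' by (intro quadrature_exact) (simp add: G_def degree_mult_eq degree_power_eq)
  \<comment> \<open>The interior nodes are zeros of \<open>P'\<close>, so only the end points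
    contribute.\<close>
  also have "\<dots> = (\<Sum>l\<in>{0, k}. \<omega> l * poly G (X l))"
    using inner by (intro sum.mono_neutral_right) (auto simp: G_def)
  also have "\<dots> = (\<omega> k - \<omega> 0) * (poly P' 1)\<^sup>2"
    using k nodes refl [of 1] by (simp add: G_def algebra_simps)
  finally have "(\<omega> k - \<omega> 0) * (poly P' 1)\<^sup>2 = 0" ..
  \<comment> \<open>Together with the \<open>k - 1\<close> interior nodes, a zero at 1 would give
    \<open>P'\<close>, of degree \<open>k - 1\<close>, too many zeros.\<close>
  moreover have "poly P' 1 \<noteq> 0"
  proof
    assume zero: "poly P' 1 = 0"
    have "P' = 0"
    proof (rule poly_eqI_degree [of "X ` {1..k}"])
      fix x assume "x \<in> X ` {1..k}"
      then obtain j where "j \<in> {1..k}" "x = X j" by auto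
      thus "poly P' x = poly 0 x" using inner [of j] zero nodes(3) by (cases "j = k") auto
    next
      have "card (X ` {1..k}) = k"
        using nodes_inj by (subst card_image) (auto intro: inj_on_subset)
      thus "degree P' < card (X ` {1..k})" "degree (0 :: real poly) < card (X ` {1..k})"
        using P' k by auto
    qed
    with P' show False by simp
  qed
  ultimately show ?thesis by simp
qed

section \<open>Summation by parts\<close>

text \<open>The derivative of the product of two basis polynomials has degree at most
  \<open>2 * k - 1\<close>, so the rule integrates it exactly. The product rule at the nodes gives
  the left side, the boundary values give the right side.\<close>

lemma summation_by_parts:
  assumes "j \<le> k" "l \<le> k"
  shows "\<omega> j * diffmat k X j l + \<omega> l * diffmat k X l j
       = of_bool (j = k \<and> l = k) - of_bool (j = 0 \<and> l = 0)"
proof -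
  let ?L = "lagrange k X"
  have L: "poly (?L i) (X m) = of_bool (m = i)" if "i \<le> k" "m \<le> k" for i m
    using poly_lagrange [OF nodes_inj] that by simp
  have "degree (?L j * ?L l) \<le> k + k"
    by (intro order.trans [OF degree_mult_le] add_mono degree_lagrange_le assms)
  hence "degree (pderiv (?L j * ?L l)) \<le> 2 * k - 1"
    unfolding degree_pderiv by simp
  hence "integral {-1..1} (poly (pderiv (?L j * ?L l)))
       = (\<Sum>m\<le>k. \<omega> m * poly (pderiv (?L j * ?L l)) (X m))"
    by (rule quadrature_exact)
  \<comment> \<open>Two separate conditionals, because both terms of the product rule count when
    \<open>j = l\<close>.\<close>
  also have "\<dots> = (\<Sum>m\<le>k. (if m = j then \<omega> m * diffmat k X m l else 0)
                        + (if m = l then \<omega> m * diffmat k X m j else 0))"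
    by (intro sum.cong refl)
       (use assms in \<open>auto simp: pderiv_mult L diffmat_def algebra_simps\<close>)
  also have "\<dots> = \<omega> j * diffmat k X j l + \<omega> l * diffmat k X l j"
    using assms by (simp add: sum.distrib)
  finally show ?thesis
    using L [OF assms(1), of 0] L [OF assms(1), of k] L [OF assms(2), of 0] L [OF assms(2), of k]
    by (auto simp: integral_poly_pderiv nodes(2,3))
qed

text \<open>The factor 2 supplies two copies of the double sum. Transposing one of them symmetrises
  the coefficients, and summation by parts leaves only the two corner entries.\<close>

lemma summation_by_parts_symmetric:
  fixes G :: "nat \<Rightarrow> nat \<Rightarrow> 'a::real_vector"
  assumes sym: "\<And>j l. j \<le> k \<Longrightarrow> l \<le> k \<Longrightarrow> G j l = G l j"
  shows "(\<Sum>j\<le>k. \<Sum>l\<le>k. (2 * \<omega> j * diffmat k X j l) *\<^sub>R G j l) = G k k - G 0 0"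
proof -
  let ?w = "\<lambda>j l. \<omega> j * diffmat k X j l"
  have "(\<Sum>j\<le>k. \<Sum>l\<le>k. ?w j l *\<^sub>R G j l) = (\<Sum>j\<le>k. \<Sum>l\<le>k. ?w l j *\<^sub>R G l j)"
    by (rule sum.swap)
  also have "\<dots> = (\<Sum>j\<le>k. \<Sum>l\<le>k. ?w l j *\<^sub>R G j l)"
    by (intro sum.cong refl) (simp add: sym)
  finally have swap: "(\<Sum>j\<le>k. \<Sum>l\<le>k. ?w j l *\<^sub>R G j l) = (\<Sum>j\<le>k. \<Sum>l\<le>k. ?w l j *\<^sub>R G j l)" .
  have "(\<Sum>j\<le>k. \<Sum>l\<le>k. (2 * \<omega> j * diffmat k X j l) *\<^sub>R G j l)
      = (\<Sum>j\<le>k. \<Sum>l\<le>k. ?w j l *\<^sub>R G j l) + (\<Sum>j\<le>k. \<Sum>l\<le>k. ?w j l *\<^sub>R G j l)"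
    by (simp only: sum.distrib [symmetric] scaleR_add_left [symmetric] mult_2 distrib_right)
  also have "\<dots> = (\<Sum>j\<le>k. \<Sum>l\<le>k. (?w j l + ?w l j) *\<^sub>R G j l)"
    by (subst (2) swap) (simp add: sum.distrib scaleR_add_left)
  also have "\<dots> = (\<Sum>j\<le>k. \<Sum>l\<le>k. (of_bool (j = k \<and> l = k) - of_bool (j = 0 \<and> l = 0)) *\<^sub>R G j l)"
    by (intro sum.cong refl) (simp add: summation_by_parts)
  also have "\<dots> = (\<Sum>j\<le>k. (if j = k then G k k else 0) - (if j = 0 then G 0 0 else 0))"
  proof (intro sum.cong refl)
    fix j
    have "(\<Sum>l\<le>k. (of_bool (j = k \<and> l = k) - of_bool (j = 0 \<and> l = 0)) *\<^sub>R G j l)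
        = (\<Sum>l\<le>k. (if l = k then of_bool (j = k) *\<^sub>R G k k else 0)
               - (if l = 0 then of_bool (j = 0) *\<^sub>R G 0 0 else 0))"
      by (intro sum.cong refl) auto
    thus "(\<Sum>l\<le>k. (of_bool (j = k \<and> l = k) - of_bool (j = 0 \<and> l = 0)) *\<^sub>R G j l)
        = (if j = k then G k k else 0) - (if j = 0 then G 0 0 else 0)"
      by (simp add: sum_subtractf)
  qed
  also have "\<dots> = G k k - G 0 0" by (simp add: sum_subtractf)
  finally show ?thesis .
qed

end

section \<open>The cone of admissible states\<close>

lemma state_components:
  "dens (U + V) = dens U + dens V" "mom (U + V) = mom U + mom V" "ener (U + V) = ener U + ener V"
  "dens (U - V) = dens U - dens V" "mom (U - V) = mom U - mom V" "ener (U - V) = ener U - ener V"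
  "dens (c *\<^sub>R U) = c * dens U" "mom (c *\<^sub>R U) = c * mom U" "ener (c *\<^sub>R U) = c * ener U"
  "dens (x, y, z) = x" "mom (x, y, z) = y" "ener (x, y, z) = z"
  by (simp_all add: dens_def mom_def ener_def)

lemma dens_sum: "dens (sum V A) = (\<Sum>x\<in>A. dens (V x))"
  by (induction A rule: infinite_finite_induct) (auto simp: state_components dens_def)

lemma mom_eq: "U \<in> admissible \<Longrightarrow> mom U = dens U * vel U"
  by (simp add: admissible_def vel_def)

lemma ener_eq: "ener U = 5 / 2 * pres U + dens U * (vel U)\<^sup>2 / 2"
  by (simp add: pres_def gam_def field_simps)

text \<open>The pressure condition is expressed by linear inequalities, one for each velocity \<open>v\<close> of a
  moving observer; this makes it evident that the set is a convex cone.\<close>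

lemma admissible_iff:
  "U \<in> admissible \<longleftrightarrow> dens U > 0 \<and> (\<forall>v. ener U - v * mom U + v\<^sup>2 / 2 * dens U > 0)"
proof (cases "dens U > 0")
  case True
  hence "mom U = dens U * vel U" by (simp add: vel_def)
  \<comment> \<open>The energy seen by the observer is the internal energy, with 5/2 = 1 / (gam -
    1), plus the kinetic energy of the relative motion; \<open>v = vel U\<close> minimises
    it.\<close>
  hence eq: "ener U - v * mom U + v\<^sup>2 / 2 * dens U = 5 / 2 * pres U + dens U / 2 * (v - vel U)\<^sup>2" for v
    by (simp add: ener_eq power2_eq_square algebra_simps)
  have "5 / 2 * pres U + dens U / 2 * (v - vel U)\<^sup>2 > 0" if "pres U > 0" for v
    using that True by (intro add_pos_nonneg) auto
  moreover have "pres U > 0" if "\<forall>v. 5 / 2 * pres U + dens U / 2 * (v - vel U)\<^sup>2 > 0"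
    using spec [OF that, of "vel U"] by simp
  ultimately show ?thesis unfolding eq using True by (auto simp: admissible_def)
qed (simp add: admissible_def)

lemma admissible_add:
  assumes "U \<in> admissible" "V \<in> admissible"
  shows "U + V \<in> admissible"
proof -
  have "ener (U + V) - v * mom (U + V) + v\<^sup>2 / 2 * dens (U + V)
      = (ener U - v * mom U + v\<^sup>2 / 2 * dens U) + (ener V - v * mom V + v\<^sup>2 / 2 * dens V)" for v
    by (simp add: state_components algebra_simps)
  thus ?thesis using assms by (simp add: admissible_iff state_components(1) add_pos_pos)
qed

lemma admissible_scaleR:
  assumes "c > 0" "U \<in> admissible"
  shows "c *\<^sub>R U \<in> admissible"
proof -
  have "ener (c *\<^sub>R U) - v * mom (c *\<^sub>R U) + v\<^sup>2 / 2 * dens (c *\<^sub>R U)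
      = c * (ener U - v * mom U + v\<^sup>2 / 2 * dens U)" for v
    by (simp add: state_components algebra_simps)
  thus ?thesis using assms by (simp add: admissible_iff state_components(7))
qed

lemma admissible_sum:
  assumes "finite A" "A \<noteq> {}" "\<And>x. x \<in> A \<Longrightarrow> V x \<in> admissible"
  shows "sum V A \<in> admissible"
  using assms by (induction A rule: finite_ne_induct) (auto intro: admissible_add)

section \<open>Lax-Friedrichs and source contributions\<close>

lemma csnd_pos: "U \<in> admissible \<Longrightarrow> csnd U > 0"
  by (simp add: admissible_def csnd_def gam_def)

text \<open>The combined state has density \<open>dens U * w\<close> with \<open>w\<close> at least
  the sound speed. Its observer energy is quadratic in \<open>v\<close> and stays positive as long
  as \<open>pres U < 5 * (w\<^sup>2 * dens U)\<close>, a weaker bound than the one the sound speed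
  provides.\<close>

lemma admissible_scaleR_flux:
  assumes U: "U \<in> admissible" and \<alpha>: "\<bar>vel U\<bar> + csnd U \<le> \<alpha>" and \<sigma>: "\<bar>\<sigma>\<bar> = 1"
  shows "\<alpha> *\<^sub>R U + \<sigma> *\<^sub>R flux U \<in> admissible"
proof -
  define w where "w = \<alpha> + \<sigma> * vel U"
  have pos: "dens U > 0" "pres U > 0" using U by (auto simp: admissible_def)
  have c: "csnd U > 0" using U by (rule csnd_pos)
  have "\<bar>\<sigma> * vel U\<bar> = \<bar>vel U\<bar>" using \<sigma> by (simp add: abs_mult)
  hence w: "csnd U \<le> w" using \<alpha> by (simp add: w_def)
  hence wpos: "w > 0" using c by simp
  have "7 / 5 * pres U / dens U = (csnd U)\<^sup>2" using pos by (simp add: csnd_def gam_def)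
  also have "\<dots> \<le> w\<^sup>2" using w c by (intro power_mono) auto
  finally have "7 / 5 * pres U \<le> w\<^sup>2 * dens U" using pos by (simp add: field_simps)
  hence "pres U < 5 * (w\<^sup>2 * dens U)" using pos by linarith
  hence disc: "0 < pres U * (5 * (w\<^sup>2 * dens U) - pres U)" using pos by simp
  have \<sigma>2: "\<sigma> * \<sigma> = 1" using \<sigma> by (metis abs_mult_self_eq mult_1)
  let ?W = "\<alpha> *\<^sub>R U + \<sigma> *\<^sub>R flux U"
  have W: "dens ?W = dens U * w" "mom ?W = dens U * vel U * w + \<sigma> * pres U"
    "ener ?W = ener U * w + \<sigma> * (vel U * pres U)"
    by (simp_all add: flux_def state_components mom_eq [OF U] w_def algebra_simps power2_eq_square)
  have "ener ?W - v * mom ?W + v\<^sup>2 / 2 * dens ?W > 0" for v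
  proof -
    \<comment> \<open>Multiplying by four times the leading coefficient in \<open>v\<close>
      completes the square without division.\<close>
    have "2 * (w * dens U) * (ener ?W - v * mom ?W + v\<^sup>2 / 2 * dens ?W)
        = (w * dens U * (v - vel U) - \<sigma> * pres U)\<^sup>2
          + (5 * (w\<^sup>2 * dens U) * pres U - (\<sigma> * \<sigma>) * (pres U * pres U))"
      unfolding W ener_eq [of U] by (simp add: power2_eq_square algebra_simps)
    also have "\<dots> > 0"
      using disc by (intro add_nonneg_pos) (auto simp: \<sigma>2 algebra_simps)
    finally show ?thesis
      using wpos pos by (metis mult_pos_pos zero_less_mult_pos zero_less_numeral)
  qed
  thus ?thesis using W(1) pos wpos by (simp add: admissible_iff)
qed

lemma lf_speed_bounds:
  "\<bar>vel UL\<bar> + csnd UL \<le> lf_speed UL UR" "\<bar>vel UR\<bar> + csnd UR \<le> lf_speed UL UR"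
  by (simp_all add: lf_speed_def)

lemma lf_speed_pos: "UL \<in> admissible \<Longrightarrow> lf_speed UL UR > 0"
  using lf_speed_bounds(1) [of UL UR] csnd_pos [of UL] by linarith

text \<open>Each result is a positive combination of an original state, with coefficient
  \<open>1 - \<mu> * \<alpha>\<close>, and the two states
  \<open>\<alpha> *\<^sub>R U + \<sigma> *\<^sub>R flux U\<close>, with \<open>\<sigma>\<close> = -1
  on the left and 1 on the right.\<close>

lemma admissible_lf_flux:
  assumes adm: "UL \<in> admissible" "UR \<in> admissible" and \<mu>: "\<mu> > 0" "\<mu> * lf_speed UL UR < 1"
  shows "UL - \<mu> *\<^sub>R lf_flux UL UR \<in> admissible" "UR + \<mu> *\<^sub>R lf_flux UL UR \<in> admissible"
proof -
  define \<alpha> where "\<alpha> = lf_speed UL UR"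
  have "\<alpha> *\<^sub>R UL + \<sigma> *\<^sub>R flux UL \<in> admissible" "\<alpha> *\<^sub>R UR + \<sigma> *\<^sub>R flux UR \<in> admissible"
    if "\<bar>\<sigma>\<bar> = 1" for \<sigma>
    using that adm unfolding \<alpha>_def by (auto intro!: admissible_scaleR_flux lf_speed_bounds)
  hence "(\<alpha> *\<^sub>R UL + \<sigma> *\<^sub>R flux UL) + (\<alpha> *\<^sub>R UR + \<sigma> *\<^sub>R flux UR) \<in> admissible"
    if "\<bar>\<sigma>\<bar> = 1" for \<sigma>
    using admissible_add that by blast
  hence "(1 - \<mu> * \<alpha>) *\<^sub>R V
      + (\<mu> / 2) *\<^sub>R ((\<alpha> *\<^sub>R UL + \<sigma> *\<^sub>R flux UL) + (\<alpha> *\<^sub>R UR + \<sigma> *\<^sub>R flux UR)) \<in> admissible"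
    if "\<bar>\<sigma>\<bar> = 1" "V \<in> admissible" for V \<sigma>
    using that \<mu> by (intro admissible_add [OF admissible_scaleR admissible_scaleR]) (auto simp: \<alpha>_def)
  from this [of "-1" UL] this [of 1 UR]
  have *: "(1 - \<mu> * \<alpha>) *\<^sub>R UL
      + (\<mu> / 2) *\<^sub>R ((\<alpha> *\<^sub>R UL + (- 1) *\<^sub>R flux UL) + (\<alpha> *\<^sub>R UR + (- 1) *\<^sub>R flux UR)) \<in> admissible"
    "(1 - \<mu> * \<alpha>) *\<^sub>R UR
      + (\<mu> / 2) *\<^sub>R ((\<alpha> *\<^sub>R UL + 1 *\<^sub>R flux UL) + (\<alpha> *\<^sub>R UR + 1 *\<^sub>R flux UR)) \<in> admissible"
    using adm by simp_all
  have "UL - \<mu> *\<^sub>R lf_flux UL UR = (1 - \<mu> * \<alpha>) *\<^sub>R UL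
      + (\<mu> / 2) *\<^sub>R ((\<alpha> *\<^sub>R UL + (- 1) *\<^sub>R flux UL) + (\<alpha> *\<^sub>R UR + (- 1) *\<^sub>R flux UR))"
    and "UR + \<mu> *\<^sub>R lf_flux UL UR = (1 - \<mu> * \<alpha>) *\<^sub>R UR
      + (\<mu> / 2) *\<^sub>R ((\<alpha> *\<^sub>R UL + 1 *\<^sub>R flux UL) + (\<alpha> *\<^sub>R UR + 1 *\<^sub>R flux UR))"
    unfolding lf_flux_def \<alpha>_def [symmetric] prod_eq_iff by (auto simp: field_simps)
  with * show "UL - \<mu> *\<^sub>R lf_flux UL UR \<in> admissible" "UR + \<mu> *\<^sub>R lf_flux UL UR \<in> admissible"
    by simp_all
qed

text \<open>The velocity becomes \<open>vel U + q\<close>, but the energy grows by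
  \<open>mom U * q\<close> only, which falls short of the kinetic gain by rho q^2 / 2. The bound on
  \<open>q\<close> says exactly that the internal energy p / (gam - 1) covers this deficit.\<close>

lemma admissible_source:
  assumes U: "U \<in> admissible"
    and q: "\<bar>q\<bar> < sqrt (1 / ((gam - 1) * (dens U / (2 * pres U))))"
  shows "U + (0, dens U * q, mom U * q) \<in> admissible"
proof -
  have pos: "dens U > 0" "pres U > 0" using U by (auto simp: admissible_def)
  let ?W = "U + (0, dens U * q, mom U * q)"
  have "sqrt (q\<^sup>2) < sqrt (5 * pres U / dens U)" using q by (simp add: gam_def)
  hence "q\<^sup>2 < 5 * pres U / dens U" by (simp only: real_sqrt_less_iff)
  hence disc: "0 < 5 / 2 * pres U - dens U / 2 * q\<^sup>2" using pos by (simp add: field_simps)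
  have "ener ?W - v * mom ?W + v\<^sup>2 / 2 * dens ?W
      = dens U / 2 * (vel U - v + q)\<^sup>2 + (5 / 2 * pres U - dens U / 2 * q\<^sup>2)" for v
    unfolding state_components ener_eq [of U] mom_eq [OF U]
    by (simp add: power2_eq_square field_simps)
  moreover have "\<dots> v > 0" for v
    using disc pos by (intro add_nonneg_pos) auto
  ultimately show ?thesis using pos by (simp add: admissible_iff state_components(1,10))
qed

section \<open>The cell average\<close>

text \<open>Both stages contract nodal values towards their mean by a factor common to the cell. The
  identity is algebraic in the two parameters, so the choice made in \<open>lim_root\<close> does
  not affect it.\<close>

lemma cell_avg_limiter:
  assumes "(\<Sum>j\<le>k. \<omega> j) = 2"
  shows "cell_avg k \<omega> (limiter k \<omega> V) = cell_avg k \<omega> V"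
proof -
  define A where "A = cell_avg k \<omega> V"
  define e :: state where "e = (1, 0, 0)"
  have half: "(\<Sum>j\<le>k. \<omega> j / 2) = 1" using assms by (simp add: sum_divide_distrib [symmetric])
  \<comment> \<open>The first stage moves each state along the density axis \<open>e\<close> only;
    these shifts average to zero.\<close>
  have "lim_dens k \<omega> V j = V j + ((1 - theta1 k \<omega> V) * (dens A - dens (V j))) *\<^sub>R e" for j
    by (simp add: lim_dens_def A_def e_def dens_def mom_def ener_def prod_eq_iff algebra_simps)
  hence "cell_avg k \<omega> (lim_dens k \<omega> V)
      = A + (\<Sum>j\<le>k. (\<omega> j / 2 * ((1 - theta1 k \<omega> V) * (dens A - dens (V j)))) *\<^sub>R e)"
    by (simp add: cell_avg_def A_def scaleR_add_right sum.distrib)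
  also have "\<dots> = A + ((1 - theta1 k \<omega> V)
      * (dens A * (\<Sum>j\<le>k. \<omega> j / 2) - (\<Sum>j\<le>k. \<omega> j / 2 * dens (V j)))) *\<^sub>R e"
    unfolding scaleR_sum_left [symmetric] sum_distrib_left sum_subtractf [symmetric]
    by (intro arg_cong2 [of _ _ _ _ "\<lambda>c v. A + c *\<^sub>R v"] sum.cong refl) (simp add: field_simps)
  also have "(\<Sum>j\<le>k. \<omega> j / 2 * dens (V j)) = dens A"
    by (simp add: A_def cell_avg_def dens_sum state_components)
  finally have lim: "cell_avg k \<omega> (lim_dens k \<omega> V) = A" by (simp add: half)
  define \<theta> where "\<theta> = theta2 k \<omega> V"
  have "cell_avg k \<omega> (limiter k \<omega> V)
      = (\<Sum>j\<le>k. \<omega> j / 2) *\<^sub>R (1 - \<theta>) *\<^sub>R A + \<theta> *\<^sub>R cell_avg k \<omega> (lim_dens k \<omega> V)"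
    unfolding cell_avg_def [of k \<omega> "limiter k \<omega> V"] limiter_def \<theta>_def [symmetric] A_def [symmetric]
    unfolding cell_avg_def scaleR_add_right sum.distrib scaleR_sum_left scaleR_sum_right
    by (simp add: mult.commute)
  thus ?thesis by (simp add: half lim A_def [symmetric] algebra_simps)
qed

section \<open>Evolution and positivity of the cell average\<close>

context gauss_lobatto_rule
begin

lemma sum_tau: "(\<Sum>j\<le>k. tau k j *\<^sub>R G j) = G k - (G 0 :: 'a::real_vector)"
proof -
  have "(\<Sum>j\<le>k. tau k j *\<^sub>R G j) = (\<Sum>j\<le>k. (if j = k then G k else 0) - (if j = 0 then G 0 else 0))"
    using k by (intro sum.cong) (auto simp: tau_def)
  thus ?thesis by (simp add: sum_subtractf)
qed

text \<open>The weight \<open>\<omega> j / 2\<close> is shared equally by two copies of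
  \<open>V j\<close>, one for the interface flux and one for the source; hence the weights
  \<open>\<omega> j / 4\<close> and the factor 4 on the step ratio.\<close>

lemma cell_avg_euler_step:
  fixes V V' S Fs :: "nat \<Rightarrow> state"
  assumes FS: "entropy_conservative FS" and adm: "\<And>j. j \<le> k \<Longrightarrow> V j \<in> admissible"
    and "dx > 0" "dt > 0"
    and scheme: "\<And>j. j \<le> k \<Longrightarrow>
        (dx / 2) *\<^sub>R ((1 / dt) *\<^sub>R (V' j - V j))
          + (\<Sum>l\<le>k. (2 * diffmat k X j l) *\<^sub>R FS (V j) (V l))
          + (tau k j / \<omega> j) *\<^sub>R (Fs j - flux (V j)) = S j"
  shows "cell_avg k \<omega> V' = (\<Sum>j\<le>k. (\<omega> j / 4) *\<^sub>R
      ((V j - (4 * (dt / dx) * (tau k j / \<omega> j)) *\<^sub>R Fs j) + (V j + (4 * (dt / dx)) *\<^sub>R S j)))"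
    (is "_ = sum ?R _")
proof -
  define r where "r = dt / dx"
  let ?f = "\<lambda>j. flux (V j)"
  let ?D = "\<lambda>j. \<Sum>l\<le>k. (2 * \<omega> j * diffmat k X j l) *\<^sub>R FS (V j) (V l)"
  have step: "(\<omega> j / 2) *\<^sub>R V' j = ?R j - r *\<^sub>R ?D j + r *\<^sub>R tau k j *\<^sub>R ?f j" if j: "j \<le> k" for j
  proof -
    define A where "A = (\<Sum>l\<le>k. (2 * diffmat k X j l) *\<^sub>R FS (V j) (V l))"
    define c where "c = tau k j / \<omega> j"
    have \<omega>: "\<omega> j > 0" using weight_pos [OF j] .
    have D: "?D j = \<omega> j *\<^sub>R A"
      by (simp add: A_def scaleR_sum_right ac_simps)
    have "V' j - V j = (2 * r) *\<^sub>R ((dx / 2) *\<^sub>R ((1 / dt) *\<^sub>R (V' j - V j)))"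
      using assms by (simp add: r_def)
    also have "(dx / 2) *\<^sub>R ((1 / dt) *\<^sub>R (V' j - V j)) = S j - A - c *\<^sub>R (Fs j - ?f j)"
      using scheme [OF j] by (simp add: A_def c_def algebra_simps)
    finally have V': "V' j = V j + (2 * r) *\<^sub>R (S j - A - c *\<^sub>R (Fs j - ?f j))"
      by (simp add: algebra_simps)
    have t: "tau k j = \<omega> j * c" using \<omega> by (simp add: c_def)
    show ?thesis
      unfolding D V' t c_def [symmetric] r_def [symmetric] prod_eq_iff using \<omega>
      by (auto simp: field_simps c_def [symmetric])
  qed
  have "(\<Sum>j\<le>k. ?D j) = FS (V k) (V k) - FS (V 0) (V 0)"
    using FS adm by (intro summation_by_parts_symmetric) (auto simp: entropy_conservative_def)
  \<comment> \<open>Consistency of the two-point flux turns the corner entries into physical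
    fluxes.\<close>
  also have "\<dots> = ?f k - ?f 0"
    using FS adm by (auto simp: entropy_conservative_def)
  finally have sbp: "(\<Sum>j\<le>k. ?D j) = ?f k - ?f 0" .
  have "cell_avg k \<omega> V' = (\<Sum>j\<le>k. ?R j - r *\<^sub>R ?D j + r *\<^sub>R tau k j *\<^sub>R ?f j)"
    unfolding cell_avg_def by (intro sum.cong) (auto simp: step)
  also have "\<dots> = (\<Sum>j\<le>k. ?R j) - r *\<^sub>R (\<Sum>j\<le>k. ?D j) + r *\<^sub>R (\<Sum>j\<le>k. tau k j *\<^sub>R ?f j)"
    by (simp only: sum.distrib sum_subtractf scaleR_sum_right)
  also have "\<dots> = (\<Sum>j\<le>k. ?R j)" unfolding sbp sum_tau by simp
  finally show ?thesis .
qed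

end


text \<open>\<open>lf_speed\<close> can exceed \<open>max_speed\<close>, through the two-rarefaction
  estimate and through the exterior states, so \<open>cfl_interface\<close> bounds the step by the
  speeds of the fluxes themselves. \<open>cfl_source\<close> is restricted to nonzero coefficients
  because \<open>1 / 0 = 0\<close> would otherwise exclude every positive step.\<close>

theorem theorem3p3:
  fixes a b dt dx :: real
    and N k :: nat
    and X \<omega> :: "nat \<Rightarrow> real"
    and \<phi> :: "real \<Rightarrow> real"
    and Ue :: "real \<Rightarrow> state"
    and FS :: "state \<Rightarrow> state \<Rightarrow> state"
    and U U_EF U_new :: "nat \<Rightarrow> nat \<Rightarrow> state"
    and \<Theta> \<beta> :: "nat \<Rightarrow> nat \<Rightarrow> real"
  assumes domain: "a < b" "N \<ge> 1" "dx = mesh_size a b N" "dt > 0"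
    and nodes: "k \<ge> 1" "gauss_lobatto k X \<omega>"
    and steady: "hydrostatic a b \<phi> Ue"
    and FS: "entropy_conservative FS"
    and \<Theta>: "\<And>i j. \<Theta> i j = source_coeff k X FS (\<lambda>l. Ue (mesh_node a b N X i l)) j"
    and scheme: "\<And>i j. i \<in> {1..N} \<Longrightarrow> j \<le> k \<Longrightarrow>
        (dx / 2) *\<^sub>R ((1 / dt) *\<^sub>R (U_EF i j - U i j))
          + (\<Sum>l\<le>k. (2 * diffmat k X j l) *\<^sub>R FS (U i j) (U i l))
          + (tau k j / \<omega> j) *\<^sub>R (interface_flux k U i j - flux (U i j))
        = (0, dens (U i j) * \<Theta> i j, mom (U i j) * \<Theta> i j)"
    and limited: "\<And>i j. i \<in> {1..N} \<Longrightarrow> j \<le> k \<Longrightarrow> U_new i j = limiter k \<omega> (U_EF i) j"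
    and adm: "\<And>i j. i \<in> {1..N} \<Longrightarrow> j \<le> k \<Longrightarrow> U i j \<in> admissible"
    and adm_exterior: "U 0 k \<in> admissible" "U (N + 1) 0 \<in> admissible"
    and \<beta>: "\<And>i j. \<beta> i j = dens (U i j) / (2 * pres (U i j))"
    and cfl: "dt / dx < \<omega> 0 / (4 * max_speed N k U)"
    and cfl_interface: "\<And>i. i \<in> {0..N} \<Longrightarrow>
        dt / dx < \<omega> 0 / (4 * lf_speed (U i k) (U (i + 1) 0))"
    and cfl_source: "\<And>i j. i \<in> {1..N} \<Longrightarrow> j \<le> k \<Longrightarrow> \<Theta> i j \<noteq> 0 \<Longrightarrow>
        dt / dx < 1 / (4 * \<bar>\<Theta> i j\<bar>) * sqrt (1 / ((gam - 1) * \<beta> i j))"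
  shows "\<forall>i\<in>{1..N}. cell_avg k \<omega> (U_new i) \<in> admissible"
proof
  fix i assume i: "i \<in> {1..N}"
  interpret gauss_lobatto_rule k X \<omega> using nodes by unfold_locales
  have dx: "dx > 0" using domain by (simp add: mesh_size_def)
  have pos: "dt / dx > 0" using dx domain by simp
  have avg: "cell_avg k \<omega> (U_new i) = cell_avg k \<omega> (U_EF i)"
  proof -
    have "cell_avg k \<omega> (U_new i) = cell_avg k \<omega> (limiter k \<omega> (U_EF i))"
      using limited [OF i] by (simp add: cell_avg_def)
    thus ?thesis by (simp add: cell_avg_limiter sum_weights)
  qed
  \<comment> \<open>Interface \<open>m\<close> separates cells \<open>m\<close> and
    \<open>m + 1\<close>; the exterior states enter at \<open>m = 0\<close> and
    \<open>m = N\<close>.\<close>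
  have states: "U m k \<in> admissible" "U (m + 1) 0 \<in> admissible" if "m \<in> {0..N}" for m
    using that adm [of m k] adm [of "m + 1" 0] adm_exterior by (cases "m = 0"; cases "m = N"; simp)+
  \<comment> \<open>The Lax-Friedrichs splitting is applied with \<open>\<mu>\<close> equal to
    \<open>4 * (dt / dx) / \<omega> 0\<close>.\<close>
  have speed: "4 * (dt / dx) / \<omega> 0 * lf_speed (U m k) (U (m + 1) 0) < 1" if "m \<in> {0..N}" for m
  proof -
    have "dt / dx * (4 * lf_speed (U m k) (U (m + 1) 0)) < \<omega> 0"
      using cfl_interface [OF that] lf_speed_pos [OF states(1) [OF that], of "U (m + 1) 0"]
      by (subst (asm) pos_less_divide_eq) auto
    hence "dt / dx * (4 * lf_speed (U m k) (U (m + 1) 0)) / \<omega> 0 < 1"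
      using weight_pos [of 0] by (subst pos_divide_less_eq) auto
    thus ?thesis by (simp add: mult_ac)
  qed
  have w: "4 * (dt / dx) / \<omega> 0 > 0"
    using dx domain(4) weight_pos [of 0] by simp
  have interface: "U i j - (4 * (dt / dx) * (tau k j / \<omega> j)) *\<^sub>R interface_flux k U i j \<in> admissible"
    if j: "j \<le> k" for j
  proof -
    consider "j = 0" | "j = k" "j \<noteq> 0" | "0 < j" "j < k" using j by linarith
    thus ?thesis
    proof cases
      case 1
      \<comment> \<open>The left end of cell \<open>i\<close> is interface \<open>i - 1\<close>;
        truncated subtraction is safe since cells start at 1.\<close>
      have m: "i - 1 \<in> {0..N}" "i - 1 + 1 = i" using i by auto
      show ?thesis
        using admissible_lf_flux(2) [OF states [OF m(1)] w speed [OF m(1)]] 1 m(2)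
        by (simp add: tau_def interface_flux_def)
    next
      case 2
      \<comment> \<open>At the right end the weight is \<open>\<omega> k\<close>, which
        \<open>weight_last\<close> identifies with the \<open>\<omega> 0\<close> of the step
        bound.\<close>
      have m: "i \<in> {0..N}" using i by auto
      show ?thesis
        using admissible_lf_flux(1) [OF states [OF m] w speed [OF m]] 2 weight_last
        by (simp add: tau_def interface_flux_def)
    next
      case 3
      thus ?thesis using adm [OF i j] by (simp add: tau_def)
    qed
  qed
  have source: "U i j + (4 * (dt / dx)) *\<^sub>R (0, dens (U i j) * \<Theta> i j, mom (U i j) * \<Theta> i j) \<in> admissible"
    if j: "j \<le> k" for j
  proof (cases "\<Theta> i j = 0")
    case True
    thus ?thesis using adm [OF i j] by (simp flip: zero_prod_def)
  next
    case False
    have "\<bar>4 * (dt / dx) * \<Theta> i j\<bar> < sqrt (1 / ((gam - 1) * \<beta> i j))"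
      using cfl_source [OF i j False] False dx domain(4) by (simp add: abs_mult field_simps)
    from admissible_source [OF adm [OF i j] this [unfolded \<beta>]]
    show ?thesis by (simp add: ac_simps)
  qed
  have "cell_avg k \<omega> (U_EF i) = (\<Sum>j\<le>k. (\<omega> j / 4) *\<^sub>R
      ((U i j - (4 * (dt / dx) * (tau k j / \<omega> j)) *\<^sub>R interface_flux k U i j)
       + (U i j + (4 * (dt / dx)) *\<^sub>R (0, dens (U i j) * \<Theta> i j, mom (U i j) * \<Theta> i j))))"
    using FS adm [OF i] dx domain(4) scheme [OF i] by (rule cell_avg_euler_step)
  also have "\<dots> \<in> admissible"
    using weight_pos
    by (intro admissible_sum admissible_scaleR admissible_add [OF interface source]) auto
  finally show "cell_avg k \<omega> (U_new i) \<in> admissible" by (simp add: avg)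
qed

end
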